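(* Let $d,\sigma>0$ with $\sigma\le d$, put $\gamma=\sigma^2/d^2\in(0,1]$, and for $\alpha\ge0$ put $\delta=\alpha/d$. Let $E(\gamma,\delta)$ be the function defined in the context. (1) Let $\{X_k,\mathcal{F}_k\}_{k\ge0}$ be a discrete-time, real-valued, conditionally symmetric supermartingale, and let $\eta_k=X_k-\mathbb{E}[X_k\mid\mathcal{F}_{k-1}]$ for $k\ge1$. Assume that, almost surely, $\eta_k\le d$ and $\operatorname{Var}(X_k\mid\mathcal{F}_{k-1})=\mathbb{E}[\eta_k^2\mid\mathcal{F}_{k-1}]\le\sigma^2$ for every integer $k\ge1$. Then for every $\alpha\ge0$ and every integer $n\ge1$, $$\mathbb{P}\Big(\max_{1\le k\le n}(X_k-X_0)\ge\alpha n\Big)\le\exp\big(-nE(\gamma,\delta)\big).$$ (2) Let $\{X_k,\mathcal{F}_k\}_{k\ge0}$ be a discrete-time, real-valued, conditionally symmetric submartingale, and let $\eta_k=X_k-\mathbb{E}[X_k\mid\mathcal{F}_{k-1}]$ for $k\ge1$. Assume that, almost surely, $\eta_k\ge-d$ and $\mathbb{E}[\eta_k^2\mid\mathcal{F}_{k-1}]\le\sigma^2$ for every integer $k\ge1$. Then for every $\alpha\ge0$ and every integer $n\ge1$, $$\mathbb{P}\Big(\min_{1\le k\le n}(X_k-X_0)\le-\alpha n\Big)\le\exp\big(-nE(\gamma,\delta)\big).$$ If $\delta>1$, then these two probabilities are zero.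
   Context: A discrete-time real-valued sub- or supermartingale $\{X_k,\mathcal{F}_k\}_{k\ge0}$ is called a conditionally symmetric sub- or supermartingale, respectively, if for every $k\ge1$, conditioned on $\mathcal{F}_{k-1}$, the random variable $\eta_k=X_k-\mathbb{E}[X_k\mid\mathcal{F}_{k-1}]$ is symmetrically distributed around zero (i.e. $\eta_k$ and $-\eta_k$ have the same conditional law given $\mathcal{F}_{k-1}$). For $\gamma\in(0,1]$ and $\delta\in[0,1)$ define $$E(\gamma,\delta)=\delta x-\ln\big(1+\gamma[\cosh(x)-1]\big),\qquad x=\ln\left(\frac{\delta(1-\gamma)+\sqrt{\delta^2(1-\gamma)^2+\gamma^2(1-\delta^2)}}{\gamma(1-\delta)}\right).$$ Moreover $E(\gamma,1)=\ln(2/\gamma)$, and $E(\gamma,\delta)=+\infty$ for $\delta>1$, with the convention $\exp(-\infty)=0$. *)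

theory Defs
  imports "HOL-Probability.Probability"
begin

locale adapted_integrable_process = prob_space M + filtration "space M" F
  for M :: "'a measure" and F :: "nat \<Rightarrow> 'a measure" +
  fixes X :: "nat \<Rightarrow> 'a \<Rightarrow> real"
  assumes subalgebra_F: "subalgebra M (F k)"
    and adapted: "X k \<in> borel_measurable (F k)"
    and integrable_X: "integrable M (X k)"

locale supermartingale = adapted_integrable_process +
  assumes supermartingale_step:
    "k \<ge> 1 \<Longrightarrow> AE \<omega> in M. real_cond_exp M (F (k - 1)) (X k) \<omega> \<le> X (k - 1) \<omega>"

locale submartingale = adapted_integrable_process +
  assumes submartingale_step:
    "k \<ge> 1 \<Longrightarrow> AE \<omega> in M. X (k - 1) \<omega> \<le> real_cond_exp M (F (k - 1)) (X k) \<omega>"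

text \<open>The innovations \<open>X\<^sub>k - E[X\<^sub>k | F\<^sub>k\<^sub>-\<^sub>1]\<close>; only the values at \<open>k \<ge> 1\<close> are meaningful.\<close>

definition innovation ::
  "'a measure \<Rightarrow> (nat \<Rightarrow> 'a measure) \<Rightarrow> (nat \<Rightarrow> 'a \<Rightarrow> real) \<Rightarrow> nat \<Rightarrow> 'a \<Rightarrow> real" where
  "innovation M F X k = (\<lambda>\<omega>. X k \<omega> - real_cond_exp M (F (k - 1)) (X k) \<omega>)"

definition conditional_probability :: "'a measure \<Rightarrow> 'a measure \<Rightarrow> 'a set \<Rightarrow> 'a \<Rightarrow> real" where
  "conditional_probability M G A = real_cond_exp M G (indicator A)"

text \<open>Equality of the conditional laws given \<open>G\<close> of two real random variables, stated event by
  event because conditional probabilities are determined only up to null sets.\<close>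

definition same_conditional_law ::
  "'a measure \<Rightarrow> 'a measure \<Rightarrow> ('a \<Rightarrow> real) \<Rightarrow> ('a \<Rightarrow> real) \<Rightarrow> bool" where
  "same_conditional_law M G Y Z \<longleftrightarrow>
    (\<forall>B \<in> sets borel. AE \<omega> in M.
      conditional_probability M G {x \<in> space M. Y x \<in> B} \<omega> =
      conditional_probability M G {x \<in> space M. Z x \<in> B} \<omega>)"

definition conditionally_symmetric ::
  "'a measure \<Rightarrow> (nat \<Rightarrow> 'a measure) \<Rightarrow> (nat \<Rightarrow> 'a \<Rightarrow> real) \<Rightarrow> bool" where
  "conditionally_symmetric M F X \<longleftrightarrow>
    (\<forall>k\<ge>1. same_conditional_law M (F (k - 1))
       (innovation M F X k) (\<lambda>\<omega>. - innovation M F X k \<omega>))"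

locale conditionally_symmetric_supermartingale = supermartingale +
  assumes cond_symmetric: "conditionally_symmetric M F X"

locale conditionally_symmetric_submartingale = submartingale +
  assumes cond_symmetric: "conditionally_symmetric M F X"

text \<open>The conditional second moment of the innovation, i.e. \<open>Var(X\<^sub>k | F\<^sub>k\<^sub>-\<^sub>1)\<close>. It is taken in
  \<^typ>\<open>ennreal\<close> since no square integrability is assumed: \<^const>\<open>real_cond_exp\<close> would
  turn an infinite conditional expectation into \<open>0\<close>.\<close>

definition conditional_variance ::
  "'a measure \<Rightarrow> (nat \<Rightarrow> 'a measure) \<Rightarrow> (nat \<Rightarrow> 'a \<Rightarrow> real) \<Rightarrow> nat \<Rightarrow> 'a \<Rightarrow> ennreal" where
  "conditional_variance M F X k =
    nn_cond_exp M (F (k - 1)) (\<lambda>\<omega>. ennreal ((innovation M F X k \<omega>)\<^sup>2))"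

definition exponent_x :: "real \<Rightarrow> real \<Rightarrow> real" where
  "exponent_x \<gamma> \<delta> =
    ln ((\<delta> * (1 - \<gamma>) + sqrt (\<delta>\<^sup>2 * (1 - \<gamma>)\<^sup>2 + \<gamma>\<^sup>2 * (1 - \<delta>\<^sup>2))) / (\<gamma> * (1 - \<delta>)))"

text \<open>The exponent \<open>E(\<gamma>, \<delta>)\<close>, meant for \<open>0 < \<gamma> \<le> 1\<close> and \<open>\<delta> \<ge> 0\<close>.\<close>

definition exponent_E :: "real \<Rightarrow> real \<Rightarrow> ereal" where
  "exponent_E \<gamma> \<delta> =
    (if \<delta> < 1 then
       let x = exponent_x \<gamma> \<delta> in ereal (\<delta> * x - ln (1 + \<gamma> * (cosh x - 1)))
     else if \<delta> = 1 then ereal (ln (2 / \<gamma>))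
     else \<infinity>)"

definition exp_ereal :: "ereal \<Rightarrow> ereal" where
  "exp_ereal y = (case y of ereal r \<Rightarrow> ereal (exp r) | PInfty \<Rightarrow> \<infinity> | MInfty \<Rightarrow> 0)"

end

theory Submission
  imports Defs "HOL-Real_Asymp.Real_Asymp"
begin

text \<open>
  Up to null sets, \<open>X\<^sub>k - X\<^sub>0\<close> is at most the sum \<open>S\<^sub>k\<close> of the innovations in the supermartingale
  case, and its negative is at most the sum of the negated innovations in the submartingale case.
  In both cases the increments \<open>Y\<^sub>k\<close> so obtained are conditionally symmetric, are bounded above by
  \<open>d\<close> and have conditional second moment at most \<open>\<sigma>\<^sup>2\<close>, so it suffices to bound the probability that
  \<open>S\<close> reaches \<open>a = \<alpha> n\<close> by time \<open>n\<close>.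

  Symmetry is used twice. It turns the one-sided bound into \<open>\<bar>Y\<^sub>k\<bar> \<le> d\<close> (\<open>abs_Y_le\<close>), and it replaces
  \<open>exp (t Y\<^sub>k)\<close> by \<open>cosh (t Y\<^sub>k)\<close> inside the conditional expectation. As
  \<open>cosh (t y) \<le> 1 + (y/d)\<^sup>2 (cosh (t d) - 1)\<close> for \<open>\<bar>y\<bar> \<le> d\<close> (\<open>cosh_scale_le\<close>), the variance bound gives
  \<open>E[exp (t Y\<^sub>k) | F\<^sub>k\<^sub>-\<^sub>1] \<le> A\<close> with \<open>A = 1 + \<gamma> (cosh (t d) - 1) \<ge> 1\<close> (\<open>conditional_mgf_le\<close>).

  The maximum costs nothing: freezing \<open>exp (t S)\<close> at \<open>exp (t a)\<close> from the first time that \<open>S\<close> reaches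
  \<open>a\<close> gives a process whose mean grows by a factor of at most \<open>A\<close> in each step, and which equals
  \<open>exp (t a)\<close> at time \<open>n\<close> on the event in question. Hence the probability is at most
  \<open>A\<^sup>n exp (- t a)\<close> (\<open>prob_crossed_le\<close>). With \<open>x = t d\<close> this is the \<open>n\<close>-th power of
  \<open>(1 + \<gamma> (cosh x - 1)) exp (- \<delta> x)\<close>, for every \<open>x \<ge> 0\<close>. Taking \<open>x\<close> as in the definition of \<open>E\<close> if
  \<open>\<delta> < 1\<close>, and letting \<open>x\<close> tend to infinity if \<open>\<delta> \<ge> 1\<close>, yields the stated bounds
  (\<open>exponential_bounds_optimised\<close>).
\<close>

section \<open>Conditional laws and conditional expectations\<close>

lemma (in finite_measure_subalgebra) same_conditional_law_measure_Int:
  assumes law: "same_conditional_law M F Y Z"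
    and [measurable]: "Y \<in> borel_measurable M" "Z \<in> borel_measurable M" "B \<in> sets borel"
    and A: "A \<in> sets F"
  shows "measure M (A \<inter> {x \<in> space M. Y x \<in> B}) = measure M (A \<inter> {x \<in> space M. Z x \<in> B})"
proof -
  have [measurable]: "A \<in> sets M" using A subalg by (meson subalgebra_def subsetD)
  have prob_as_integral: "measure M (A \<inter> C)
      = (\<integral>x\<in>A. conditional_probability M F C x \<partial>M)" if [measurable]: "C \<in> sets M" for C
  proof -
    have "measure M (A \<inter> C) = (\<integral>x\<in>A. indicator C x \<partial>M)"
      by (simp add: set_lebesgue_integral_def flip: indicator_inter_arith)
    also have "\<dots> = (\<integral>x\<in>A. conditional_probability M F C x \<partial>M)"
      unfolding conditional_probability_def
      by (rule real_cond_exp_intA) (auto simp: A emeasure_finite less_top[symmetric])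
    finally show ?thesis .
  qed
  have "AE x in M. conditional_probability M F {x \<in> space M. Y x \<in> B} x
      = conditional_probability M F {x \<in> space M. Z x \<in> B} x"
    using law assms(4) by (auto simp: same_conditional_law_def)
  then have "(\<integral>x\<in>A. conditional_probability M F {x \<in> space M. Y x \<in> B} x \<partial>M)
      = (\<integral>x\<in>A. conditional_probability M F {x \<in> space M. Z x \<in> B} x \<partial>M)"
    unfolding conditional_probability_def set_lebesgue_integral_def
    by (intro integral_cong_AE) (auto elim!: eventually_mono)
  then show ?thesis by (simp add: prob_as_integral)
qed

lemma (in finite_measure_subalgebra) same_conditional_law_set_nn_integral:
  assumes law: "same_conditional_law M F Y Z"
    and [measurable]: "Y \<in> borel_measurable M" "Z \<in> borel_measurable M"
    and A: "A \<in> sets F" and [measurable]: "g \<in> borel_measurable borel"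
  shows "(\<integral>\<^sup>+x\<in>A. g (Y x) \<partial>M) = (\<integral>\<^sup>+x\<in>A. g (Z x) \<partial>M)"
proof -
  have [measurable]: "A \<in> sets M" using A subalg by (meson subalgebra_def subsetD)
  let ?N = "density M (indicator A)"
  have law_on_A: "emeasure (distr ?N borel U) B = emeasure M (A \<inter> {x \<in> space M. U x \<in> B})"
    if [measurable]: "U \<in> borel_measurable M" "B \<in> sets borel" for U :: "'a \<Rightarrow> real" and B
  proof -
    have "emeasure (distr ?N borel U) B = emeasure ?N {x \<in> space M. U x \<in> B}"
      by (subst emeasure_distr) (auto intro!: arg_cong[where f = "emeasure ?N"])
    also have "\<dots> = emeasure M (A \<inter> {x \<in> space M. U x \<in> B})"
      by (subst emeasure_density) (auto simp flip: indicator_inter_arith)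
    finally show ?thesis .
  qed
  have distr_eq: "distr ?N borel Y = distr ?N borel Z"
  proof (rule measure_eqI)
    fix B assume "B \<in> sets (distr ?N borel Y)"
    then have B: "B \<in> sets borel" by simp
    show "emeasure (distr ?N borel Y) B = emeasure (distr ?N borel Z) B"
      using same_conditional_law_measure_Int[OF law assms(2,3) B A]
      by (simp add: law_on_A B emeasure_eq_measure)
  qed simp
  have transport: "(\<integral>\<^sup>+x\<in>A. g (U x) \<partial>M) = (\<integral>\<^sup>+y. g y \<partial>distr ?N borel U)"
    if [measurable]: "U \<in> borel_measurable M" for U :: "'a \<Rightarrow> real"
    by (subst nn_integral_distr) (auto simp: nn_integral_density mult.commute)
  show ?thesis by (simp add: transport distr_eq)
qed

text \<open>Equality of conditional laws is given event by event, each event with its own null set.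
  Integrating over a set of the conditioning \<open>\<sigma>\<close>-algebra turns it into equality of two genuine
  measures on the line, from which all conditional expectations of functions can be read off.\<close>

lemma (in finite_measure_subalgebra) same_conditional_law_nn_cond_exp:
  assumes law: "same_conditional_law M F Y Z"
    and [measurable]: "Y \<in> borel_measurable M" "Z \<in> borel_measurable M" "g \<in> borel_measurable borel"
  shows "AE x in M. nn_cond_exp M F (\<lambda>x. g (Y x)) x = nn_cond_exp M F (\<lambda>x. g (Z x)) x"
proof -
  have "AE x in M. nn_cond_exp M F (\<lambda>x. g (Z x)) x = nn_cond_exp M F (\<lambda>x. g (Y x)) x"
  proof (rule nn_cond_exp_charact)
    fix A assume A: "A \<in> sets F"
    have "(\<integral>\<^sup>+x\<in>A. nn_cond_exp M F (\<lambda>x. g (Z x)) x \<partial>M) = (\<integral>\<^sup>+x\<in>A. g (Z x) \<partial>M)"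
      using nn_cond_exp_intg[of "indicator A" "\<lambda>x. g (Z x)"] A by (simp add: mult.commute)
    then show "(\<integral>\<^sup>+x\<in>A. g (Y x) \<partial>M) = (\<integral>\<^sup>+x\<in>A. nn_cond_exp M F (\<lambda>x. g (Z x)) x \<partial>M)"
      using same_conditional_law_set_nn_integral[OF law _ _ A, of g] by simp
  qed auto
  then show ?thesis by (auto elim!: eventually_mono)
qed

lemma (in finite_measure_subalgebra) nn_cond_exp_affine:
  assumes [measurable]: "f \<in> borel_measurable M"
  shows "AE x in M. nn_cond_exp M F (\<lambda>x. a + b * f x) x = a + b * nn_cond_exp M F f x"
proof -
  have "AE x in M. nn_cond_exp M F (\<lambda>x. a) x + nn_cond_exp M F (\<lambda>x. b * f x) x
      = nn_cond_exp M F (\<lambda>x. a + b * f x) x"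
    by (rule nn_cond_exp_sum) auto
  moreover have "AE x in M. a = nn_cond_exp M F (\<lambda>x. a) x"
    by (rule nn_cond_exp_F_meas) auto
  moreover have "AE x in M. b * nn_cond_exp M F f x = nn_cond_exp M F (\<lambda>x. b * f x) x"
    by (rule nn_cond_exp_prod) auto
  ultimately show ?thesis by eventually_elim simp
qed

section \<open>Exponential bounds for conditionally symmetric increments\<close>

text \<open>Every term \<open>u\<^sup>n / n!\<close> of the series of \<open>cosh u - 1\<close> has \<open>n \<ge> 2\<close>, so scaling the argument by
  \<open>r\<close> scales it by at most \<open>r\<^sup>2\<close>.\<close>

lemma cosh_scale_le:
  fixes r u :: real
  assumes r: "\<bar>r\<bar> \<le> 1"
  shows "cosh (r * u) \<le> 1 + r\<^sup>2 * (cosh u - 1)"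
proof -
  have parabola_sums: "(\<lambda>n. (if n = 0 then 1 - r\<^sup>2 else 0) + r\<^sup>2 * (if even n then u ^ n /\<^sub>R fact n else 0))
      sums ((1 - r\<^sup>2) + r\<^sup>2 * cosh u)"
    using sums_If_finite_set[of "{0::nat}" "\<lambda>_. 1 - r\<^sup>2"]
    by (intro sums_add sums_mult cosh_converges) simp
  have "(if even n then (r * u) ^ n /\<^sub>R fact n else 0)
      \<le> (if n = 0 then 1 - r\<^sup>2 else 0) + r\<^sup>2 * (if even n then u ^ n /\<^sub>R fact n else 0)" for n
  proof (cases "even n \<and> n \<noteq> 0")
    case True
    then have n: "even n" "2 \<le> n" by (auto elim!: evenE)
    have "r ^ n = \<bar>r\<bar> ^ n" using n by (simp add: power_even_abs)
    also have "\<dots> \<le> \<bar>r\<bar>\<^sup>2" using n r by (intro power_decreasing) auto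
    finally have "r ^ n \<le> r\<^sup>2" by simp
    then have "r ^ n * (u ^ n / fact n) \<le> r\<^sup>2 * (u ^ n / fact n)"
      using n by (intro mult_right_mono) (auto simp: zero_le_even_power)
    then show ?thesis using True by (simp add: power_mult_distrib field_simps)
  qed auto
  then have "cosh (r * u) \<le> (1 - r\<^sup>2) + r\<^sup>2 * cosh u"
    by (rule sums_le[OF _ cosh_converges parabola_sums])
  then show ?thesis by (simp add: algebra_simps)
qed

text \<open>This captures what the innovations of the supermartingale and the negated innovations of the
  submartingale have in common. The index is shifted so that \<open>F k\<close> is the past of \<open>Y (Suc k)\<close>.\<close>

locale symmetric_increments = prob_space M + filtration "space M" F
  for M :: "'a measure" and F :: "nat \<Rightarrow> 'a measure" +
  fixes Y :: "nat \<Rightarrow> 'a \<Rightarrow> real" and d v :: real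
  assumes subalgebra_F: "subalgebra M (F k)"
    and adapted_Y: "Y (Suc k) \<in> borel_measurable (F (Suc k))"
    and symmetric_Y: "same_conditional_law M (F k) (Y (Suc k)) (\<lambda>\<omega>. - Y (Suc k) \<omega>)"
    and Y_le: "AE \<omega> in M. Y (Suc k) \<omega> \<le> d"
    and variance_le: "AE \<omega> in M. nn_cond_exp M (F k) (\<lambda>\<omega>. ennreal ((Y (Suc k) \<omega>)\<^sup>2)) \<omega> \<le> ennreal v"
    and d_pos: "0 < d"
    and v_nonneg: "0 \<le> v"
begin

lemma finite_measure_subalgebra_F: "finite_measure_subalgebra M (F k)"
  by (intro finite_measure_subalgebra.intro finite_measure_subalgebra_axioms.intro
      finite_measure_axioms subalgebra_F)

lemma Y_borel_measurable [measurable]: "Y (Suc k) \<in> borel_measurable M"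
  using measurable_from_subalg[OF subalgebra_F adapted_Y] .

lemma borel_measurable_F_mono:
  assumes "f \<in> borel_measurable (F i)" "i \<le> j"
  shows "f \<in> borel_measurable (F j)"
  by (rule measurable_from_subalg[OF _ assms(1)])
    (use sets_F_mono[OF assms(2)] in \<open>simp add: subalgebra_def space_F\<close>)

text \<open>By symmetry, the events \<open>Y > d\<close> and \<open>- Y > d\<close> have the same probability, which is zero.\<close>

lemma abs_Y_le: "AE \<omega> in M. \<bar>Y (Suc k) \<omega>\<bar> \<le> d"
proof -
  interpret Fk: finite_measure_subalgebra M "F k" by (rule finite_measure_subalgebra_F)
  have "measure M (space M \<inter> {\<omega> \<in> space M. Y (Suc k) \<omega> \<in> {d<..}})
      = measure M (space M \<inter> {\<omega> \<in> space M. - Y (Suc k) \<omega> \<in> {d<..}})"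
    using space_F[of k] sets.top[of "F k"]
    by (intro Fk.same_conditional_law_measure_Int[OF symmetric_Y]) auto
  moreover have "measure M (space M \<inter> {\<omega> \<in> space M. Y (Suc k) \<omega> \<in> {d<..}}) = 0"
    using Y_le[of k] by (subst prob_eq_0) (auto elim!: eventually_mono)
  ultimately have "AE \<omega> in M. \<omega> \<notin> space M \<inter> {\<omega> \<in> space M. - Y (Suc k) \<omega> \<in> {d<..}}"
    by (subst prob_eq_0[symmetric]) auto
  with Y_le[of k] AE_space show ?thesis by eventually_elim auto
qed

definition mgf_bound :: "real \<Rightarrow> real" where
  "mgf_bound t = 1 + v / d\<^sup>2 * (cosh (t * d) - 1)"

lemma mgf_bound_ge_1: "1 \<le> mgf_bound t"
  using v_nonneg cosh_real_ge_1[of "t * d"] by (simp add: mgf_bound_def)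

text \<open>Symmetry replaces \<open>exp (t Y)\<close> by \<open>cosh (t Y)\<close> under the conditional expectation. On
  \<open>[-d, d]\<close> the latter lies below the parabola in \<open>Y\<close> through its values at \<open>0\<close> and \<open>\<plusminus>d\<close>, whose
  conditional expectation involves only the variance.\<close>

lemma conditional_mgf_le:
  "AE \<omega> in M. nn_cond_exp M (F k) (\<lambda>\<omega>. ennreal (exp (t * Y (Suc k) \<omega>))) \<omega> \<le> ennreal (mgf_bound t)"
proof -
  interpret Fk: finite_measure_subalgebra M "F k" by (rule finite_measure_subalgebra_F)
  let ?E = "nn_cond_exp M (F k)" and ?Y = "Y (Suc k)"
  define c where "c = (cosh (t * d) - 1) / d\<^sup>2"
  have c_nonneg: "0 \<le> c" using cosh_real_ge_1[of "t * d"] by (simp add: c_def)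
  have exp_pair_le: "exp (t * y) + exp (t * - y) \<le> 2 + 2 * c * y\<^sup>2" if "\<bar>y\<bar> \<le> d" for y
  proof -
    have "cosh ((y / d) * (t * d)) \<le> 1 + (y / d)\<^sup>2 * (cosh (t * d) - 1)"
      using that d_pos by (intro cosh_scale_le) simp
    then have "cosh (t * y) \<le> 1 + c * y\<^sup>2"
      using d_pos by (simp add: c_def power_divide mult_ac)
    then show ?thesis by (simp add: cosh_def)
  qed
  have "AE \<omega> in M. ?E (\<lambda>\<omega>. ennreal (exp (t * ?Y \<omega>))) \<omega> = ?E (\<lambda>\<omega>. ennreal (exp (t * - ?Y \<omega>))) \<omega>"
    using Fk.same_conditional_law_nn_cond_exp[OF symmetric_Y, of "\<lambda>y. ennreal (exp (t * y))"] by simp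
  moreover have "AE \<omega> in M. ?E (\<lambda>\<omega>. ennreal (exp (t * ?Y \<omega>))) \<omega> + ?E (\<lambda>\<omega>. ennreal (exp (t * - ?Y \<omega>))) \<omega>
      = ?E (\<lambda>\<omega>. ennreal (exp (t * ?Y \<omega>)) + ennreal (exp (t * - ?Y \<omega>))) \<omega>"
    by (rule Fk.nn_cond_exp_sum) auto
  moreover have "AE \<omega> in M. ?E (\<lambda>\<omega>. ennreal (exp (t * ?Y \<omega>)) + ennreal (exp (t * - ?Y \<omega>))) \<omega>
      \<le> ?E (\<lambda>\<omega>. ennreal 2 + ennreal (2 * c) * ennreal ((?Y \<omega>)\<^sup>2)) \<omega>"
  proof (rule Fk.nn_cond_exp_mono)
    show "AE \<omega> in M. ennreal (exp (t * ?Y \<omega>)) + ennreal (exp (t * - ?Y \<omega>))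
        \<le> ennreal 2 + ennreal (2 * c) * ennreal ((?Y \<omega>)\<^sup>2)"
      using abs_Y_le[of k]
    proof eventually_elim
      case (elim \<omega>)
      have "ennreal (exp (t * ?Y \<omega>) + exp (t * - ?Y \<omega>)) \<le> ennreal (2 + 2 * c * (?Y \<omega>)\<^sup>2)"
        by (intro ennreal_leI exp_pair_le elim)
      then show ?case
        using c_nonneg by (simp add: ennreal_mult del: ennreal_numeral)
    qed
  qed auto
  moreover have "AE \<omega> in M. ?E (\<lambda>\<omega>. ennreal 2 + ennreal (2 * c) * ennreal ((?Y \<omega>)\<^sup>2)) \<omega>
      = ennreal 2 + ennreal (2 * c) * ?E (\<lambda>\<omega>. ennreal ((?Y \<omega>)\<^sup>2)) \<omega>"
    by (rule Fk.nn_cond_exp_affine) auto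
  ultimately show ?thesis using variance_le[of k]
  proof eventually_elim
    case (elim \<omega>)
    let ?e = "?E (\<lambda>\<omega>. ennreal (exp (t * ?Y \<omega>))) \<omega>"
    have "ennreal 2 * ?e = ?e + ?e" by (simp add: mult_2)
    also have "\<dots> \<le> ennreal 2 + ennreal (2 * c) * ?E (\<lambda>\<omega>. ennreal ((?Y \<omega>)\<^sup>2)) \<omega>"
      using elim(1-4) by simp
    also have "\<dots> \<le> ennreal 2 + ennreal (2 * c) * ennreal v"
      by (intro add_left_mono mult_left_mono elim(5)) simp
    also have "\<dots> = ennreal (2 + 2 * c * v)"
      using c_nonneg v_nonneg by (simp add: ennreal_mult del: ennreal_numeral)
    also have "\<dots> = ennreal 2 * ennreal (mgf_bound t)"
      by (subst ennreal_mult[symmetric]) (use mgf_bound_ge_1[of t] in \<open>auto simp: mgf_bound_def c_def algebra_simps\<close>)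
    finally show ?case by (simp add: ennreal_mult_le_mult_iff)
  qed
qed

lemma nn_integral_mult_exp_le:
  assumes Z: "Z \<in> borel_measurable (F k)"
  shows "(\<integral>\<^sup>+\<omega>. Z \<omega> * ennreal (exp (t * Y (Suc k) \<omega>)) \<partial>M) \<le> ennreal (mgf_bound t) * (\<integral>\<^sup>+\<omega>. Z \<omega> \<partial>M)"
proof -
  interpret Fk: finite_measure_subalgebra M "F k" by (rule finite_measure_subalgebra_F)
  have [measurable]: "Z \<in> borel_measurable M" using measurable_from_subalg[OF subalgebra_F Z] .
  have "(\<integral>\<^sup>+\<omega>. Z \<omega> * ennreal (exp (t * Y (Suc k) \<omega>)) \<partial>M)
      = (\<integral>\<^sup>+\<omega>. Z \<omega> * nn_cond_exp M (F k) (\<lambda>\<omega>. ennreal (exp (t * Y (Suc k) \<omega>))) \<omega> \<partial>M)"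
    by (rule Fk.nn_cond_exp_intg[symmetric]) (use Z in auto)
  also have "\<dots> \<le> (\<integral>\<^sup>+\<omega>. ennreal (mgf_bound t) * Z \<omega> \<partial>M)"
    by (rule nn_integral_mono_AE)
      (use conditional_mgf_le[of k t] in \<open>eventually_elim, simp add: mult.commute mult_left_mono\<close>)
  also have "\<dots> = ennreal (mgf_bound t) * (\<integral>\<^sup>+\<omega>. Z \<omega> \<partial>M)"
    by (rule nn_integral_cmult) simp
  finally show ?thesis .
qed

section \<open>The maximal inequality\<close>

definition partial_sum :: "nat \<Rightarrow> 'a \<Rightarrow> real" where
  "partial_sum m \<omega> = (\<Sum>k=1..m. Y k \<omega>)"

definition crossed :: "real \<Rightarrow> nat \<Rightarrow> 'a \<Rightarrow> bool" where
  "crossed a m \<omega> \<longleftrightarrow> (\<exists>k\<in>{1..m}. a \<le> partial_sum k \<omega>)"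

lemma partial_sum_0 [simp]: "partial_sum 0 \<omega> = 0"
  by (simp add: partial_sum_def)

lemma partial_sum_Suc: "partial_sum (Suc m) \<omega> = partial_sum m \<omega> + Y (Suc m) \<omega>"
  by (simp add: partial_sum_def)

lemma crossed_0 [simp]: "\<not> crossed a 0 \<omega>"
  by (simp add: crossed_def)

lemma crossed_Suc: "crossed a (Suc m) \<omega> \<longleftrightarrow> crossed a m \<omega> \<or> a \<le> partial_sum (Suc m) \<omega>"
  by (auto simp: crossed_def atLeastAtMostSuc_conv)

lemma partial_sum_adapted: "partial_sum m \<in> borel_measurable (F m)"
proof (induction m)
  case (Suc m)
  show ?case
    unfolding partial_sum_Suc[abs_def]
    by (intro borel_measurable_add adapted_Y borel_measurable_F_mono[OF Suc]) simp
qed (simp add: partial_sum_def[abs_def])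

lemma crossed_adapted: "Measurable.pred (F m) (crossed a m)"
proof -
  have [measurable]: "partial_sum k \<in> borel_measurable (F m)" if "k \<in> {1..m}" for k
    using that by (intro borel_measurable_F_mono[OF partial_sum_adapted]) simp
  show ?thesis unfolding crossed_def[abs_def] by measurable
qed

lemma partial_sum_borel_measurable [measurable]: "partial_sum m \<in> borel_measurable M"
  using measurable_from_subalg[OF subalgebra_F partial_sum_adapted] .

lemma crossed_measurable [measurable]: "Measurable.pred M (crossed a m)"
  using measurable_from_subalg[OF subalgebra_F crossed_adapted] .

text \<open>The exponential process frozen at the level \<open>exp (t a)\<close> from the first time \<open>k \<ge> 1\<close> at
  which the sum is at least \<open>a\<close>; time \<open>0\<close> is excluded, so that it starts at \<open>1\<close> even if \<open>a \<le> 0\<close>.\<close>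

definition frozen_exp :: "real \<Rightarrow> real \<Rightarrow> nat \<Rightarrow> 'a \<Rightarrow> ennreal" where
  "frozen_exp t a m \<omega> = ennreal (exp (t * (if crossed a m \<omega> then a else partial_sum m \<omega>)))"

lemma frozen_exp_adapted: "frozen_exp t a m \<in> borel_measurable (F m)"
proof -
  note [measurable] = crossed_adapted partial_sum_adapted
  show ?thesis unfolding frozen_exp_def[abs_def] by measurable
qed

text \<open>Freezing at \<open>exp (t a)\<close> rather than at the actual, possibly larger, value only lowers the
  process. Hence one step multiplies its mean by at most the conditional moment bound where it
  still moves, and by \<open>1\<close>, which is no larger, where it is frozen.\<close>

lemma nn_integral_frozen_exp_Suc_le:
  assumes t: "0 \<le> t"
  shows "(\<integral>\<^sup>+\<omega>. frozen_exp t a (Suc m) \<omega> \<partial>M) \<le> ennreal (mgf_bound t) * (\<integral>\<^sup>+\<omega>. frozen_exp t a m \<omega> \<partial>M)"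
proof -
  let ?stopped = "\<lambda>\<omega>. if crossed a m \<omega> then frozen_exp t a m \<omega> else 0"
  let ?running = "\<lambda>\<omega>. if crossed a m \<omega> then 0 else frozen_exp t a m \<omega>"
  let ?A = "ennreal (mgf_bound t)"
  have A_ge_1: "1 \<le> ?A" using ennreal_leI[OF mgf_bound_ge_1[of t]] by simp
  have [measurable]: "frozen_exp t a k \<in> borel_measurable M" for k
    using measurable_from_subalg[OF subalgebra_F frozen_exp_adapted] .
  have running_adapted: "?running \<in> borel_measurable (F m)"
  proof -
    note [measurable] = crossed_adapted frozen_exp_adapted
    show ?thesis by measurable
  qed
  have "frozen_exp t a (Suc m) \<omega> \<le> ?stopped \<omega> + ?running \<omega> * ennreal (exp (t * Y (Suc m) \<omega>))" for \<omega>
  proof -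
    have "exp (t * a) \<le> exp (t * (partial_sum m \<omega> + Y (Suc m) \<omega>))"
      if "a \<le> partial_sum m \<omega> + Y (Suc m) \<omega>"
      using that t by (simp add: mult_left_mono)
    then show ?thesis
      by (auto simp: frozen_exp_def crossed_Suc partial_sum_Suc distrib_left exp_add
          ennreal_mult[symmetric] intro!: ennreal_leI)
  qed
  then have "(\<integral>\<^sup>+\<omega>. frozen_exp t a (Suc m) \<omega> \<partial>M)
      \<le> (\<integral>\<^sup>+\<omega>. ?stopped \<omega> + ?running \<omega> * ennreal (exp (t * Y (Suc m) \<omega>)) \<partial>M)"
    by (intro nn_integral_mono)
  also have "\<dots> = (\<integral>\<^sup>+\<omega>. ?stopped \<omega> \<partial>M) + (\<integral>\<^sup>+\<omega>. ?running \<omega> * ennreal (exp (t * Y (Suc m) \<omega>)) \<partial>M)"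
    by (rule nn_integral_add) auto
  also have "\<dots> \<le> ?A * (\<integral>\<^sup>+\<omega>. ?stopped \<omega> \<partial>M) + ?A * (\<integral>\<^sup>+\<omega>. ?running \<omega> \<partial>M)"
    using mult_right_mono[OF A_ge_1, of "\<integral>\<^sup>+\<omega>. ?stopped \<omega> \<partial>M"]
    by (intro add_mono nn_integral_mult_exp_le running_adapted) simp_all
  also have "\<dots> = ?A * (\<integral>\<^sup>+\<omega>. ?stopped \<omega> + ?running \<omega> \<partial>M)"
    by (subst nn_integral_add) (auto simp: distrib_left)
  also have "(\<lambda>\<omega>. ?stopped \<omega> + ?running \<omega>) = frozen_exp t a m" by auto
  finally show ?thesis .
qed

lemma nn_integral_frozen_exp_le:
  assumes "0 \<le> t"
  shows "(\<integral>\<^sup>+\<omega>. frozen_exp t a m \<omega> \<partial>M) \<le> ennreal (mgf_bound t) ^ m"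
proof (induction m)
  case 0
  show ?case by (simp add: frozen_exp_def emeasure_space_1)
next
  case (Suc m)
  note nn_integral_frozen_exp_Suc_le[OF assms]
  also have "ennreal (mgf_bound t) * (\<integral>\<^sup>+\<omega>. frozen_exp t a m \<omega> \<partial>M) \<le> ennreal (mgf_bound t) ^ Suc m"
    by (simp add: mult_left_mono Suc)
  finally show ?case .
qed

lemma prob_crossed_le:
  assumes "0 \<le> t"
  shows "measure M {\<omega> \<in> space M. crossed a n \<omega>} \<le> mgf_bound t ^ n * exp (- (t * a))"
proof -
  let ?C = "{\<omega> \<in> space M. crossed a n \<omega>}"
  have "ennreal (exp (t * a) * measure M ?C) = (\<integral>\<^sup>+\<omega>. ennreal (exp (t * a)) * indicator ?C \<omega> \<partial>M)"
    by (subst nn_integral_cmult_indicator) (auto simp: ennreal_mult emeasure_eq_measure)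
  also have "\<dots> \<le> (\<integral>\<^sup>+\<omega>. frozen_exp t a n \<omega> \<partial>M)"
    by (intro nn_integral_mono) (auto simp: frozen_exp_def indicator_def)
  also have "\<dots> \<le> ennreal (mgf_bound t ^ n)"
    using nn_integral_frozen_exp_le[OF assms, of a n] mgf_bound_ge_1[of t] by (simp add: ennreal_power)
  finally have "exp (t * a) * measure M ?C \<le> mgf_bound t ^ n"
    using mgf_bound_ge_1[of t] by (subst (asm) ennreal_le_iff) auto
  then show ?thesis by (simp add: exp_minus field_simps)
qed

text \<open>The form in which the bound is optimised: \<open>t = x / d\<close>, and the process need only be dominated
  by the sum of the increments.\<close>

lemma prob_dominated_process_crosses_le:
  assumes dominated: "AE \<omega> in M. \<forall>k\<ge>1. W k \<omega> \<le> partial_sum k \<omega>" and x: "0 \<le> x"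
  shows "measure M {\<omega> \<in> space M. \<exists>k\<in>{1..n}. \<alpha> * real n \<le> W k \<omega>}
    \<le> ((1 + v / d\<^sup>2 * (cosh x - 1)) * exp (- (\<alpha> / d * x))) ^ n"
proof -
  have "measure M {\<omega> \<in> space M. \<exists>k\<in>{1..n}. \<alpha> * real n \<le> W k \<omega>}
      \<le> measure M {\<omega> \<in> space M. crossed (\<alpha> * real n) n \<omega>}"
  proof (rule finite_measure_mono_AE)
    show "AE \<omega> in M. \<omega> \<in> {\<omega> \<in> space M. \<exists>k\<in>{1..n}. \<alpha> * real n \<le> W k \<omega>}
        \<longrightarrow> \<omega> \<in> {\<omega> \<in> space M. crossed (\<alpha> * real n) n \<omega>}"
      using dominated by eventually_elim (force simp: crossed_def intro: order_trans)
  qed measurable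
  also have "\<dots> \<le> mgf_bound (x / d) ^ n * exp (- (x / d * (\<alpha> * real n)))"
    using x d_pos by (intro prob_crossed_le) simp
  also have "\<dots> = ((1 + v / d\<^sup>2 * (cosh x - 1)) * exp (- (\<alpha> / d * x))) ^ n"
    using d_pos by (simp add: mgf_bound_def power_mult_distrib mult_ac flip: exp_of_nat_mult)
  finally show ?thesis .
qed

end

section \<open>Optimising the exponent\<close>

text \<open>The moment bounds control the upper tail only for \<open>x \<ge> 0\<close>, so the optimal \<open>x\<close> must be admissible.\<close>

lemma exponent_x_nonneg:
  assumes \<gamma>: "0 < \<gamma>" "\<gamma> \<le> 1" and \<delta>: "0 \<le> \<delta>" "\<delta> < 1"
  shows "0 \<le> exponent_x \<gamma> \<delta>"
proof -
  have "(1 - \<delta>)\<^sup>2 \<le> 1 - \<delta>\<^sup>2"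
    using mult_nonneg_nonneg[of \<delta> "1 - \<delta>"] \<delta> by (simp add: power2_eq_square algebra_simps)
  then have "(\<gamma> * (1 - \<delta>))\<^sup>2 \<le> \<delta>\<^sup>2 * (1 - \<gamma>)\<^sup>2 + \<gamma>\<^sup>2 * (1 - \<delta>\<^sup>2)"
    by (simp add: power_mult_distrib mult_left_mono add_increasing)
  then have "\<gamma> * (1 - \<delta>) \<le> sqrt (\<delta>\<^sup>2 * (1 - \<gamma>)\<^sup>2 + \<gamma>\<^sup>2 * (1 - \<delta>\<^sup>2))"
    by (rule real_le_rsqrt)
  then have "\<gamma> * (1 - \<delta>) \<le> \<delta> * (1 - \<gamma>) + sqrt (\<delta>\<^sup>2 * (1 - \<gamma>)\<^sup>2 + \<gamma>\<^sup>2 * (1 - \<delta>\<^sup>2))"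
    using \<gamma> \<delta> by (simp add: add_increasing)
  then show ?thesis
    unfolding exponent_x_def using \<gamma> \<delta> by (intro ln_ge_zero) (simp add: le_divide_eq)
qed

text \<open>For \<open>\<delta> < 1\<close> the exponent is attained at \<open>exponent_x\<close>; for \<open>\<delta> = 1\<close> it is the supremum,
  approached as \<open>x\<close> tends to infinity; for \<open>\<delta> > 1\<close> the bounds tend to zero along the same limit.\<close>

lemma exponential_bounds_optimised:
  fixes p \<gamma> \<delta> :: real
  assumes \<gamma>: "0 < \<gamma>" "\<gamma> \<le> 1" and \<delta>: "0 \<le> \<delta>" and n: "n \<ge> 1" and p: "0 \<le> p"
    and bound: "\<And>x. 0 \<le> x \<Longrightarrow> p \<le> ((1 + \<gamma> * (cosh x - 1)) * exp (- (\<delta> * x))) ^ n"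
  shows "ereal p \<le> exp_ereal (- (ereal (real n) * exponent_E \<gamma> \<delta>)) \<and> (\<delta> > 1 \<longrightarrow> p = 0)"
proof -
  have limit_bound: "p \<le> c ^ n"
    if "((\<lambda>x. (1 + \<gamma> * (cosh x - 1)) * exp (- (\<delta> * x))) \<longlongrightarrow> c) at_top" for c
    by (rule tendsto_lowerbound[OF tendsto_power[OF that]])
      (auto intro: eventually_mono[OF eventually_ge_at_top[of 0]] bound)
  consider "\<delta> < 1" | "\<delta> = 1" | "\<delta> > 1" by linarith
  then show ?thesis
  proof cases
    case 1
    let ?x = "exponent_x \<gamma> \<delta>"
    let ?A = "1 + \<gamma> * (cosh ?x - 1)"
    have A_pos: "0 < ?A" using \<gamma> cosh_real_ge_1[of ?x] by (simp add: add_pos_nonneg)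
    have "p \<le> (?A * exp (- (\<delta> * ?x))) ^ n"
      by (rule bound) (rule exponent_x_nonneg[OF \<gamma> \<delta> 1])
    also have "?A * exp (- (\<delta> * ?x)) = exp (- (\<delta> * ?x - ln ?A))"
      using A_pos by (simp add: exp_diff exp_minus field_simps)
    also have "\<dots> ^ n = exp (- (real n * (\<delta> * ?x - ln ?A)))"
      by (simp add: algebra_simps flip: exp_of_nat_mult)
    finally show ?thesis using 1 by (simp add: exponent_E_def exp_ereal_def Let_def)
  next
    case 2
    have "((\<lambda>x. (1 + \<gamma> * (cosh x - 1)) * exp (- (\<delta> * x))) \<longlongrightarrow> \<gamma> / 2) at_top"
      unfolding cosh_field_def 2 using \<gamma> by real_asymp
    then have "p \<le> (\<gamma> / 2) ^ n" by (rule limit_bound)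
    also have "\<gamma> / 2 = exp (- ln (2 / \<gamma>))" using \<gamma> by (simp add: exp_minus)
    also have "\<dots> ^ n = exp (- (real n * ln (2 / \<gamma>)))" by (simp flip: exp_of_nat_mult)
    finally show ?thesis using 2 by (simp add: exponent_E_def exp_ereal_def)
  next
    case 3
    have "((\<lambda>x. (1 + \<gamma> * (cosh x - 1)) * exp (- (\<delta> * x))) \<longlongrightarrow> 0) at_top"
      unfolding cosh_field_def using \<gamma> 3 by real_asymp
    then have "p \<le> 0 ^ n" by (rule limit_bound)
    then have "p = 0" using n p by (simp add: power_0_left)
    then show ?thesis using 3 n by (simp add: exponent_E_def exp_ereal_def)
  qed
qed

section \<open>Martingale innovations as symmetric increments\<close>

context adapted_integrable_process
begin

lemma innovation_adapted: "innovation M F X (Suc k) \<in> borel_measurable (F (Suc k))"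
proof -
  have "real_cond_exp M (F k) (X (Suc k)) \<in> borel_measurable (F (Suc k))"
    by (rule measurable_from_subalg[of _ "F k"])
      (use sets_F_mono[of k "Suc k"] in \<open>simp_all add: subalgebra_def space_F\<close>)
  then show ?thesis using adapted[of "Suc k"] by (simp add: innovation_def)
qed

end

context supermartingale
begin

text \<open>The predictable part of a supermartingale decreases, so only the innovations push it upwards.\<close>

lemma displacement_le_sum_innovations:
  "AE \<omega> in M. \<forall>k\<ge>1. X k \<omega> - X 0 \<omega> \<le> (\<Sum>j=1..k. innovation M F X j \<omega>)"
proof -
  have "AE \<omega> in M. \<forall>k. real_cond_exp M (F k) (X (Suc k)) \<omega> \<le> X k \<omega>"
    unfolding AE_all_countable using supermartingale_step[of "Suc k" for k] by simp
  then show ?thesis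
  proof eventually_elim
    case (elim \<omega>)
    have "X k \<omega> - X 0 \<omega> \<le> (\<Sum>j=1..k. innovation M F X j \<omega>)" for k
    proof (induction k)
      case (Suc k)
      then show ?case using elim[rule_format, of k] by (simp add: innovation_def)
    qed simp
    then show ?case by blast
  qed
qed

end

context submartingale
begin

lemma displacement_ge_sum_innovations:
  "AE \<omega> in M. \<forall>k\<ge>1. (\<Sum>j=1..k. innovation M F X j \<omega>) \<le> X k \<omega> - X 0 \<omega>"
proof -
  have "AE \<omega> in M. \<forall>k. X k \<omega> \<le> real_cond_exp M (F k) (X (Suc k)) \<omega>"
    unfolding AE_all_countable using submartingale_step[of "Suc k" for k] by simp
  then show ?thesis
  proof eventually_elim
    case (elim \<omega>)
    have "(\<Sum>j=1..k. innovation M F X j \<omega>) \<le> X k \<omega> - X 0 \<omega>" for k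
    proof (induction k)
      case (Suc k)
      then show ?case using elim[rule_format, of k] by (simp add: innovation_def)
    qed simp
    then show ?case by blast
  qed
qed

end

lemma (in conditionally_symmetric_supermartingale) symmetric_increments_innovation:
  assumes "0 < d" "0 \<le> v"
    and "\<forall>k\<ge>1. AE \<omega> in M. innovation M F X k \<omega> \<le> d"
    and "\<forall>k\<ge>1. AE \<omega> in M. conditional_variance M F X k \<omega> \<le> ennreal v"
  shows "symmetric_increments M F (innovation M F X) d v"
proof unfold_locales
  fix k
  show "same_conditional_law M (F k) (innovation M F X (Suc k)) (\<lambda>\<omega>. - innovation M F X (Suc k) \<omega>)"
    using cond_symmetric by (auto simp: conditionally_symmetric_def dest: spec[of _ "Suc k"])
  show "AE \<omega> in M. nn_cond_exp M (F k) (\<lambda>\<omega>. ennreal ((innovation M F X (Suc k) \<omega>)\<^sup>2)) \<omega> \<le> ennreal v"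
    using assms(4)[rule_format, of "Suc k"] by (simp add: conditional_variance_def)
qed (use assms in \<open>auto intro: subalgebra_F innovation_adapted\<close>)

lemma same_conditional_law_sym:
  "same_conditional_law M G Y Z \<Longrightarrow> same_conditional_law M G Z Y"
  by (fastforce simp: same_conditional_law_def elim: eventually_mono)

lemma (in conditionally_symmetric_submartingale) symmetric_increments_minus_innovation:
  assumes "0 < d" "0 \<le> v"
    and "\<forall>k\<ge>1. AE \<omega> in M. innovation M F X k \<omega> \<ge> - d"
    and "\<forall>k\<ge>1. AE \<omega> in M. conditional_variance M F X k \<omega> \<le> ennreal v"
  shows "symmetric_increments M F (\<lambda>k \<omega>. - innovation M F X k \<omega>) d v"
proof unfold_locales
  fix k
  have "same_conditional_law M (F k) (innovation M F X (Suc k)) (\<lambda>\<omega>. - innovation M F X (Suc k) \<omega>)"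
    using cond_symmetric by (auto simp: conditionally_symmetric_def dest: spec[of _ "Suc k"])
  then show "same_conditional_law M (F k) (\<lambda>\<omega>. - innovation M F X (Suc k) \<omega>)
      (\<lambda>\<omega>. - (- innovation M F X (Suc k) \<omega>))"
    by (auto intro: same_conditional_law_sym)
  show "AE \<omega> in M. nn_cond_exp M (F k) (\<lambda>\<omega>. ennreal ((- innovation M F X (Suc k) \<omega>)\<^sup>2)) \<omega> \<le> ennreal v"
    using assms(4)[rule_format, of "Suc k"] by (simp add: conditional_variance_def)
  show "AE \<omega> in M. - innovation M F X (Suc k) \<omega> \<le> d"
    using assms(3)[rule_format, of "Suc k"] by (auto elim!: eventually_mono)
qed (use assms in \<open>auto intro: subalgebra_F innovation_adapted\<close>)

section \<open>The tail bounds\<close>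


theorem corollary2:
  fixes M :: "'a measure" and d \<sigma> \<alpha> \<gamma> \<delta> :: real and n :: nat
  assumes "0 < d" and "0 < \<sigma>" and "\<sigma> \<le> d"
    and "\<gamma> = \<sigma>\<^sup>2 / d\<^sup>2"
    and "0 \<le> \<alpha>" and "\<delta> = \<alpha> / d"
    and "n \<ge> 1"
  shows
    "(\<forall>(F :: nat \<Rightarrow> 'a measure) X.
        conditionally_symmetric_supermartingale M F X \<longrightarrow>
        (\<forall>k\<ge>1. AE \<omega> in M. innovation M F X k \<omega> \<le> d) \<longrightarrow>
        (\<forall>k\<ge>1. AE \<omega> in M. conditional_variance M F X k \<omega> \<le> ennreal (\<sigma>\<^sup>2)) \<longrightarrow>
        (let p = measure M {\<omega> \<in> space M. Max ((\<lambda>k. X k \<omega> - X 0 \<omega>) ` {1..n}) \<ge> \<alpha> * real n}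
         in ereal p \<le> exp_ereal (- (ereal (real n) * exponent_E \<gamma> \<delta>)) \<and>
            (\<delta> > 1 \<longrightarrow> p = 0))) \<and>
     (\<forall>(F :: nat \<Rightarrow> 'a measure) X.
        conditionally_symmetric_submartingale M F X \<longrightarrow>
        (\<forall>k\<ge>1. AE \<omega> in M. innovation M F X k \<omega> \<ge> - d) \<longrightarrow>
        (\<forall>k\<ge>1. AE \<omega> in M. conditional_variance M F X k \<omega> \<le> ennreal (\<sigma>\<^sup>2)) \<longrightarrow>
        (let p = measure M {\<omega> \<in> space M. Min ((\<lambda>k. X k \<omega> - X 0 \<omega>) ` {1..n}) \<le> - \<alpha> * real n}
         in ereal p \<le> exp_ereal (- (ereal (real n) * exponent_E \<gamma> \<delta>)) \<and>
            (\<delta> > 1 \<longrightarrow> p = 0)))"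
proof -
  have \<gamma>: "0 < \<gamma>" "\<gamma> \<le> 1"
    using assms(1-4) by (simp_all add: power_mono)
  have \<delta>: "0 \<le> \<delta>" using assms(1,5,6) by simp
  have super: "let p = measure M {\<omega> \<in> space M. Max ((\<lambda>k. X k \<omega> - X 0 \<omega>) ` {1..n}) \<ge> \<alpha> * real n}
      in ereal p \<le> exp_ereal (- (ereal (real n) * exponent_E \<gamma> \<delta>)) \<and> (\<delta> > 1 \<longrightarrow> p = 0)"
    if X: "conditionally_symmetric_supermartingale M F X"
      and bound: "\<forall>k\<ge>1. AE \<omega> in M. innovation M F X k \<omega> \<le> d"
      and var: "\<forall>k\<ge>1. AE \<omega> in M. conditional_variance M F X k \<omega> \<le> ennreal (\<sigma>\<^sup>2)"
    for F :: "nat \<Rightarrow> 'a measure" and X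
  proof -
    interpret conditionally_symmetric_supermartingale M F X by (rule X)
    interpret Y: symmetric_increments M F "innovation M F X" d "\<sigma>\<^sup>2"
      by (rule symmetric_increments_innovation) (use assms(1) bound var in auto)
    have event: "{\<omega> \<in> space M. Max ((\<lambda>k. X k \<omega> - X 0 \<omega>) ` {1..n}) \<ge> \<alpha> * real n}
        = {\<omega> \<in> space M. \<exists>k\<in>{1..n}. \<alpha> * real n \<le> X k \<omega> - X 0 \<omega>}"
      using assms(7) by (auto simp: Max_ge_iff)
    have dominated: "AE \<omega> in M. \<forall>k\<ge>1. X k \<omega> - X 0 \<omega> \<le> Y.partial_sum k \<omega>"
      using displacement_le_sum_innovations by (simp add: Y.partial_sum_def)
    show ?thesis
      unfolding Let_def event
      using Y.prob_dominated_process_crosses_le[OF dominated, where \<alpha> = \<alpha> and n = n]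
      by (intro exponential_bounds_optimised \<gamma> \<delta> assms(7) measure_nonneg) (simp add: assms(4,6))
  qed
  have sub: "let p = measure M {\<omega> \<in> space M. Min ((\<lambda>k. X k \<omega> - X 0 \<omega>) ` {1..n}) \<le> - \<alpha> * real n}
      in ereal p \<le> exp_ereal (- (ereal (real n) * exponent_E \<gamma> \<delta>)) \<and> (\<delta> > 1 \<longrightarrow> p = 0)"
    if X: "conditionally_symmetric_submartingale M F X"
      and bound: "\<forall>k\<ge>1. AE \<omega> in M. innovation M F X k \<omega> \<ge> - d"
      and var: "\<forall>k\<ge>1. AE \<omega> in M. conditional_variance M F X k \<omega> \<le> ennreal (\<sigma>\<^sup>2)"
    for F :: "nat \<Rightarrow> 'a measure" and X
  proof -
    interpret conditionally_symmetric_submartingale M F X by (rule X)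
    interpret Y: symmetric_increments M F "\<lambda>k \<omega>. - innovation M F X k \<omega>" d "\<sigma>\<^sup>2"
      by (rule symmetric_increments_minus_innovation) (use assms(1) bound var in auto)
    have event: "{\<omega> \<in> space M. Min ((\<lambda>k. X k \<omega> - X 0 \<omega>) ` {1..n}) \<le> - \<alpha> * real n}
        = {\<omega> \<in> space M. \<exists>k\<in>{1..n}. \<alpha> * real n \<le> - (X k \<omega> - X 0 \<omega>)}"
      using assms(7) by (force simp: Min_le_iff)
    have dominated: "AE \<omega> in M. \<forall>k\<ge>1. - (X k \<omega> - X 0 \<omega>) \<le> Y.partial_sum k \<omega>"
      using displacement_ge_sum_innovations
      by eventually_elim (fastforce simp: Y.partial_sum_def sum_negf)
    show ?thesis
      unfolding Let_def event
      using Y.prob_dominated_process_crosses_le[OF dominated, where \<alpha> = \<alpha> and n = n]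
      by (intro exponential_bounds_optimised \<gamma> \<delta> assms(7) measure_nonneg) (simp add: assms(4,6))
  qed
  show ?thesis using super sub by blast
qed

end
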